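(* Let $\mathcal G$ be a connected weighted graph on $n\ge2$ nodes with total edge weight $W(\mathcal G)=\sum_{e}w_{\mathcal G}(e)$. Then $$\rho_{ss}(L_{\mathcal G};M_n)\ \ge\ \frac{(n-1)^2}{4W(\mathcal G)}.$$
   Context: Graphs are finite, simple, undirected, with positive edge weights $w_{\mathcal G}(e)$. The Laplacian $L_{\mathcal G}$ is (diagonal matrix of weighted degrees) minus (weighted adjacency matrix), with eigenvalues $0=\lambda_1<\lambda_2\le\dots\le\lambda_n$. $M_n=I_n-\frac1nJ_n$ is the centering matrix, and $\rho_{ss}(L_{\mathcal G};M_n)=\frac12\sum_{i=2}^n\lambda_i^{-1}$ is the performance measure of the first-order consensus network $\dot x=-L_{\mathcal G}x+\xi$, $y=M_nx$. *)

theory Defs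
  imports
    Complex_Main
    "HOL-Computational_Algebra.Polynomial"
    "HOL-Library.Multiset"
    "Jordan_Normal_Form.Char_Poly"
begin

text \<open>
  Finite simple undirected graphs on the node set \<open>{..<n}\<close>: edges are two-element sets of nodes
  (hence no loops and no parallel edges), each carrying a positive weight.
\<close>

locale weighted_graph =
  fixes n :: nat
    and E :: "nat set set"
    and w :: "nat set \<Rightarrow> real"
  assumes edges: "E \<subseteq> {e. e \<subseteq> {..<n} \<and> card e = 2}"
    and weight_pos: "\<And>e. e \<in> E \<Longrightarrow> w e > 0"

definition graph_connected :: "nat \<Rightarrow> nat set set \<Rightarrow> bool" where
  "graph_connected n E \<longleftrightarrow> (\<forall>u<n. \<forall>v<n. (u, v) \<in> {(a, b). {a, b} \<in> E}\<^sup>*)"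

definition total_weight :: "nat set set \<Rightarrow> (nat set \<Rightarrow> real) \<Rightarrow> real" where
  "total_weight E w = (\<Sum>e\<in>E. w e)"

definition weighted_degree :: "nat set set \<Rightarrow> (nat set \<Rightarrow> real) \<Rightarrow> nat \<Rightarrow> real" where
  "weighted_degree E w i = (\<Sum>e | e \<in> E \<and> i \<in> e. w e)"

definition degree_matrix :: "nat \<Rightarrow> nat set set \<Rightarrow> (nat set \<Rightarrow> real) \<Rightarrow> real mat" where
  "degree_matrix n E w = mat n n (\<lambda>(i, j). if i = j then weighted_degree E w i else 0)"

definition adjacency_matrix :: "nat \<Rightarrow> nat set set \<Rightarrow> (nat set \<Rightarrow> real) \<Rightarrow> real mat" where
  "adjacency_matrix n E w = mat n n (\<lambda>(i, j). if {i, j} \<in> E then w {i, j} else 0)"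

definition laplacian :: "nat \<Rightarrow> nat set set \<Rightarrow> (nat set \<Rightarrow> real) \<Rightarrow> real mat" where
  "laplacian n E w = degree_matrix n E w - adjacency_matrix n E w"

text \<open>
  The real eigenvalues in nondecreasing order, repeated according to algebraic multiplicity.
  For a symmetric real matrix of dimension \<open>n\<close>, such as a Laplacian, this list has length \<open>n\<close>.
\<close>

definition sorted_eigenvalues :: "real mat \<Rightarrow> real list" where
  "sorted_eigenvalues A = sorted_list_of_multiset (proots (char_poly A))"

text \<open>
  Performance measure of the consensus network \<open>x' = -L x + \<xi>\<close>, whose output is \<open>x\<close> multiplied by
  the centering matrix \<open>I - J/n\<close>; centering removes the smallest Laplacian eigenvalue \<open>0\<close> from the
  sum. List indices start at \<open>0\<close>, so index \<open>i - 1\<close> is the \<open>i\<close>-th smallest eigenvalue.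
\<close>

definition rho_ss :: "real mat \<Rightarrow> real" where
  "rho_ss L = 1/2 * (\<Sum>i = 2..dim_row L. inverse (sorted_eigenvalues L ! (i - 1)))"

end

theory Submission
  imports Defs "Jordan_Normal_Form.Schur_Decomposition"
begin

text \<open>
  The Laplacian is symmetric with trace \<open>2 W\<close>, every edge contributing its weight to the degrees of
  its two endpoints. Its quadratic form \<open>x \<bullet> (L x)\<close> is half the sum of the terms
  \<open>w\<^bsub>ij\<^esub> (x\<^sub>i - x\<^sub>j)\<^sup>2\<close> over all ordered pairs, so all eigenvalues are nonnegative, and on a connected
  graph the kernel consists of the constant vectors only. Hence \<open>\<lambda>\<^sub>2, \<dots>, \<lambda>\<^sub>n\<close> are positive, with sum
  at most \<open>2 W\<close>, and the inequality between the harmonic and the arithmetic mean gives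
  \<open>\<Sum>\<^bsub>i \<ge> 2\<^esub> 1 / \<lambda>\<^sub>i \<ge> (n - 1)\<^sup>2 / (2 W)\<close>. Half of this is the claim.

  The eigenvalues here are roots of the characteristic polynomial, counted with multiplicity, so the
  argument rests on three facts about a symmetric real matrix: its characteristic polynomial
  splits over the reals (\<open>symmetric_real_char_poly_splits\<close>), its trace is the sum of the roots
  (\<open>trace_eq_sum_eigenvalues\<close>), and a double root has two linearly independent
  eigenvectors (\<open>symmetric_double_eigenvalue_independent_eigenvectors\<close>). The last one transfers the
  one-dimensionality of the kernel to the algebraic multiplicity of the root \<open>0\<close>. It and the trace
  formula are read off a real Schur decomposition.
\<close>

section \<open>Eigenvalues of symmetric real matrices\<close>

text \<open>
  For an eigenvector \<open>v\<close> the number \<open>S = v\<^sup>* A v\<close> equals \<open>z \<bar>v\<bar>\<^sup>2\<close>; symmetry of the real matrix \<open>A\<close>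
  makes \<open>S\<close> invariant under conjugation, so \<open>z\<close> is real.
\<close>

lemma symmetric_real_complex_eigenvalue_Reals:
  fixes A :: "real mat" and z :: complex
  assumes A: "A \<in> carrier_mat n n" and sym: "A\<^sup>T = A"
    and root: "poly (char_poly (map_mat of_real A)) z = 0"
  shows "z \<in> \<real>"
proof -
  let ?C = "map_mat of_real A :: complex mat"
  have C: "?C \<in> carrier_mat n n" using A by simp
  have A_sym: "A $$ (i, j) = A $$ (j, i)" if "i < n" "j < n" for i j
    using sym A that by (metis carrier_matD index_transpose_mat(1))
  from root obtain v where v: "v \<in> carrier_vec n" "v \<noteq> 0\<^sub>v n" "?C *\<^sub>v v = z \<cdot>\<^sub>v v"
    using C unfolding eigenvalue_root_char_poly[OF C, symmetric] eigenvalue_def eigenvector_def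
    by auto
  have row: "(\<Sum>j<n. of_real (A $$ (i, j)) * v $ j) = z * v $ i" if "i < n" for i
  proof -
    have "(?C *\<^sub>v v) $ i = (\<Sum>j<n. of_real (A $$ (i, j)) * v $ j)"
      using A v(1) that by (simp add: scalar_prod_def lessThan_atLeast0)
    then show ?thesis using v(1,3) that by simp
  qed
  define S where "S = (\<Sum>i<n. \<Sum>j<n. cnj (v $ i) * of_real (A $$ (i, j)) * v $ j)"
  define N where "N = (\<Sum>i<n. (cmod (v $ i))\<^sup>2)"
  have "S = (\<Sum>i<n. cnj (v $ i) * (z * v $ i))"
    unfolding S_def by (intro sum.cong refl) (simp add: row[symmetric] sum_distrib_left mult.assoc)
  also have "\<dots> = z * of_real N"
    unfolding N_def of_real_sum sum_distrib_left
    by (intro sum.cong refl) (simp add: complex_norm_square mult.commute mult.left_commute del: of_real_power)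
  finally have S: "S = z * of_real N" .
  have "cnj S = (\<Sum>i<n. \<Sum>j<n. cnj (v $ j) * of_real (A $$ (i, j)) * v $ i)"
    unfolding S_def by (simp add: mult.commute mult.left_commute)
  also have "\<dots> = S"
    unfolding S_def by (subst sum.swap) (intro sum.cong refl, simp add: A_sym)
  finally have "cnj z * of_real N = z * of_real N" by (simp add: S)
  moreover have "N \<noteq> 0"
  proof
    assume "N = 0"
    then have "v $ i = 0" if "i < n" for i
      using that unfolding N_def by (subst (asm) sum_nonneg_eq_0_iff) auto
    with v(1) have "v = 0\<^sub>v n" by (intro eq_vecI) auto
    with v(2) show False ..
  qed
  ultimately have "cnj z = z" by simp
  then show ?thesis by (simp add: Reals_cnj_iff)
qed

text \<open>
  The characteristic polynomial splits over the complex numbers, and the previous lemma shows that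
  each factor there comes from a real one.
\<close>

lemma symmetric_real_char_poly_splits:
  fixes A :: "real mat"
  assumes A: "A \<in> carrier_mat n n" and sym: "A\<^sup>T = A"
  obtains es where "char_poly A = (\<Prod>e\<leftarrow>es. [:- e, 1:])" "length es = n"
proof -
  interpret h: map_poly_inj_idom_hom "of_real :: real \<Rightarrow> complex" ..
  let ?C = "map_mat of_real A :: complex mat"
  have C: "?C \<in> carrier_mat n n" using A by simp
  obtain zs where zs: "char_poly ?C = (\<Prod>z\<leftarrow>zs. [:- z, 1:])" "length zs = n"
    using char_poly_factorized[OF C] by blast
  have "z \<in> \<real>" if "z \<in> set zs" for z
    using symmetric_real_complex_eigenvalue_Reals[OF A sym, of z] that
    unfolding zs(1) by (force simp: poly_prod_list prod_list_zero_iff)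
  then have zs_Re: "map (\<lambda>z. of_real (Re z)) zs = zs"
    by (intro map_idI) (auto elim: Reals_cases)
  have "map_poly of_real (char_poly A) = char_poly ?C"
    by (rule of_real_hom.char_poly_hom[OF A, symmetric])
  also have "\<dots> = (\<Prod>z\<leftarrow>map (\<lambda>z. of_real (Re z)) zs. [:- z, 1:])"
    unfolding zs_Re by (rule zs(1))
  also have "\<dots> = map_poly of_real (\<Prod>e\<leftarrow>map Re zs. [:- e, 1:])"
    by (simp add: h.hom_prod_list o_def)
  finally have "char_poly A = (\<Prod>e\<leftarrow>map Re zs. [:- e, 1:])" by simp
  then show ?thesis by (rule that) (simp add: zs(2))
qed

lemma proots_prod_linear_factors:
  fixes es :: "'a :: idom list"
  shows "proots (\<Prod>e\<leftarrow>es. [:- e, 1:]) = mset es"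
proof (induction es)
  case (Cons e es)
  have "(\<Prod>e\<leftarrow>es. [:- e, 1:]) \<noteq> 0" by (auto simp: prod_list_zero_iff)
  with Cons show ?case by (simp add: proots_mult del: mult_pCons_left)
qed simp

lemma
  fixes A :: "real mat"
  assumes A: "A \<in> carrier_mat n n" and sym: "A\<^sup>T = A"
  shows char_poly_sorted_eigenvalues: "char_poly A = (\<Prod>e\<leftarrow>sorted_eigenvalues A. [:- e, 1:])"
    and length_sorted_eigenvalues: "length (sorted_eigenvalues A) = n"
proof -
  obtain es where es: "char_poly A = (\<Prod>e\<leftarrow>es. [:- e, 1:])" "length es = n"
    using symmetric_real_char_poly_splits[OF A sym] .
  have sorted: "mset (sorted_eigenvalues A) = mset es"
    by (simp add: sorted_eigenvalues_def es(1) proots_prod_linear_factors)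
  then show "length (sorted_eigenvalues A) = n"
    using es(2) by (metis size_mset)
  from sorted have "mset (map (\<lambda>e. [:- e, 1:]) (sorted_eigenvalues A)) = mset (map (\<lambda>e. [:- e, 1:]) es)"
    by simp
  then show "char_poly A = (\<Prod>e\<leftarrow>sorted_eigenvalues A. [:- e, 1:])"
    unfolding es(1) by (metis prod_mset_prod_list)
qed

lemma similar_mat_wit_trace_eq:
  fixes A B :: "'a :: comm_ring_1 mat"
  assumes A: "A \<in> carrier_mat n n" and wit: "similar_mat_wit A B P Q"
  shows "sum_list (diag_mat A) = sum_list (diag_mat B)"
proof -
  have trace: "sum_list (diag_mat (X * Y)) = (\<Sum>i<n. \<Sum>j<n. X $$ (i, j) * Y $$ (j, i))"
    if "X \<in> carrier_mat n n" "Y \<in> carrier_mat n n" for X Y :: "'a mat"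
    using that by (simp add: diag_mat_def scalar_prod_def lessThan_atLeast0 interv_sum_list_conv_sum_set_nat)
  note w = similar_mat_witD2[OF A wit]
  have "sum_list (diag_mat A) = sum_list (diag_mat ((P * B) * Q))" using w(3) by simp
  also have "\<dots> = sum_list (diag_mat (Q * (P * B)))"
    using w by (simp only: trace mult_carrier_mat) (subst sum.swap, simp add: mult.commute)
  also have "Q * (P * B) = B" using w by (simp flip: assoc_mult_mat)
  finally show ?thesis .
qed

lemma trace_eq_sum_eigenvalues:
  fixes A :: "'a :: conjugatable_ordered_field mat"
  assumes A: "A \<in> carrier_mat n n" and es: "char_poly A = (\<Prod>e\<leftarrow>es. [:- e, 1:])"
  shows "sum_list (diag_mat A) = sum_list es"
proof -
  obtain B P Q where "schur_decomposition A es = (B, P, Q)" by (metis prod_cases3)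
  then show ?thesis
    using schur_decomposition[OF A es] similar_mat_wit_trace_eq[OF A] by metis
qed

text \<open>
  The Schur decomposition \<open>A = P B P\<^sup>-\<^sup>1\<close> can be taken with any ordering of the eigenvalues on the
  diagonal of \<open>B\<close>. With \<open>k\<close> in the first two places, the first two columns \<open>u\<close> and \<open>v\<close> of \<open>P\<close>
  are linearly independent and satisfy \<open>A u = k u\<close> and \<open>A v = c u + k v\<close>. Symmetry gives
  \<open>u \<bullet> (A v) = (A u) \<bullet> v = k (u \<bullet> v)\<close>,
  hence \<open>c (u \<bullet> u) = 0\<close> and \<open>c = 0\<close>.
\<close>

lemma symmetric_double_eigenvalue_independent_eigenvectors:
  fixes A :: "real mat"
  assumes A: "A \<in> carrier_mat n n" and sym: "A\<^sup>T = A"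
    and es: "char_poly A = (\<Prod>e\<leftarrow>k # k # es. [:- e, 1:])"
  obtains u v where "u \<in> carrier_vec n" "v \<in> carrier_vec n"
    "A *\<^sub>v u = k \<cdot>\<^sub>v u" "A *\<^sub>v v = k \<cdot>\<^sub>v v"
    "\<And>a b. a \<cdot>\<^sub>v u + b \<cdot>\<^sub>v v = 0\<^sub>v n \<Longrightarrow> a = 0 \<and> b = 0"
proof -
  obtain B P Q where schur: "schur_decomposition A (k # k # es) = (B, P, Q)"
    by (metis prod_cases3)
  have wit: "similar_mat_wit A B P Q" and tri: "upper_triangular B"
    and diag: "diag_mat B = k # k # es"
    using schur_decomposition[OF A es schur] by auto
  note w = similar_mat_witD2[OF A wit]
  have n: "n \<ge> 2" using arg_cong[OF diag, of length] w(5) by (simp add: diag_mat_def)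
  have B00: "B $$ (0, 0) = k" and B11: "B $$ (1, 1) = k"
    using arg_cong[OF diag, of "\<lambda>xs. xs ! 0"] arg_cong[OF diag, of "\<lambda>xs. xs ! 1"] w(5) n
    by (simp_all add: diag_mat_def)
  define u v c where "u = col P 0" and "v = col P 1" and "c = B $$ (0, 1)"
  have uv: "u \<in> carrier_vec n" "v \<in> carrier_vec n"
    using w(6) n by (auto simp: u_def v_def)
  have AP: "A * P = P * B"
  proof -
    have "A * P = P * B * (Q * P)" using w by (simp add: assoc_mult_mat[of _ n n _ n _ n])
    then show ?thesis using w by simp
  qed
  have AP_col: "A *\<^sub>v col P j = P *\<^sub>v col B j" if "j < n" for j
    using col_mult2[OF A w(6) that] col_mult2[OF w(6) w(5) that] AP by simp
  have B_low: "B $$ (i, j) = 0" if "j < i" "i < n" for i j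
    using tri that w(5) by (auto simp: upper_triangular_def)
  have Au: "A *\<^sub>v u = k \<cdot>\<^sub>v u"
  proof (rule eq_vecI)
    fix i assume "i < dim_vec (k \<cdot>\<^sub>v u)"
    then have i: "i < n" using uv by simp
    have "(A *\<^sub>v u) $ i = (\<Sum>j<n. P $$ (i, j) * B $$ (j, 0))"
      using AP_col[of 0] n i w by (simp add: u_def scalar_prod_def lessThan_atLeast0)
    also have "\<dots> = (\<Sum>j\<in>{0}. P $$ (i, j) * B $$ (j, 0))"
      using n by (intro sum.mono_neutral_right) (auto simp: B_low)
    finally show "(A *\<^sub>v u) $ i = (k \<cdot>\<^sub>v u) $ i"
      using i n w by (simp add: u_def B00)
  qed (use A uv in auto)
  have Av: "A *\<^sub>v v = c \<cdot>\<^sub>v u + k \<cdot>\<^sub>v v"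
  proof (rule eq_vecI)
    fix i assume "i < dim_vec (c \<cdot>\<^sub>v u + k \<cdot>\<^sub>v v)"
    then have i: "i < n" using uv by simp
    have "(A *\<^sub>v v) $ i = (\<Sum>j<n. P $$ (i, j) * B $$ (j, 1))"
      using AP_col[of 1] n i w by (simp add: v_def scalar_prod_def lessThan_atLeast0)
    also have "\<dots> = (\<Sum>j\<in>{0, 1}. P $$ (i, j) * B $$ (j, 1))"
      using n by (intro sum.mono_neutral_right) (auto simp: B_low)
    finally show "(A *\<^sub>v v) $ i = (c \<cdot>\<^sub>v u + k \<cdot>\<^sub>v v) $ i"
      using i n w B11 by (simp add: u_def v_def c_def)
  qed (use A uv in auto)
  have QP: "row Q i \<bullet> col P j = (if i = j then 1 else 0)" if "i < n" "j < n" for i j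
    using arg_cong[OF w(2), of "\<lambda>M. M $$ (i, j)"] that w(6,7) by simp
  have indep: "a = 0 \<and> b = 0" if "a \<cdot>\<^sub>v u + b \<cdot>\<^sub>v v = 0\<^sub>v n" for a b
  proof -
    note zero = that
    \<comment> \<open>The rows of \<open>Q\<close>, the inverse of \<open>P\<close>, form the basis dual to the columns of \<open>P\<close>.\<close>
    have "a * (row Q i \<bullet> u) + b * (row Q i \<bullet> v) = 0" if i: "i < n" for i
    proof -
      have "row Q i \<bullet> (a \<cdot>\<^sub>v u + b \<cdot>\<^sub>v v) = a * (row Q i \<bullet> u) + b * (row Q i \<bullet> v)"
        using uv w(7) i by (simp add: scalar_prod_add_distrib[of _ n])
      then show ?thesis using zero w(7) i by simp
    qed
    from this[of 0] this[of 1] show ?thesis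
      using n QP by (simp add: u_def v_def)
  qed
  have "c = 0"
  proof -
    have "u \<bullet> (A *\<^sub>v v) = (A *\<^sub>v u) \<bullet> v"
      using transpose_vec_mult_scalar[OF A uv(2) uv(1)] sym by simp
    then have "c * (u \<bullet> u) = 0"
      using uv by (simp add: Au Av scalar_prod_add_distrib[of _ n])
    moreover have "u \<bullet> u \<noteq> 0"
    proof
      assume "u \<bullet> u = 0"
      then have "u = 0\<^sub>v n"
        using uv(1) conjugate_square_eq_0_vec[OF uv(1)] by (simp add: scalar_prod_def)
      then have "1 \<cdot>\<^sub>v u + 0 \<cdot>\<^sub>v v = 0\<^sub>v n"
        using uv(2) by (intro eq_vecI) auto
      then show False using indep[of 1 0] by simp
    qed
    ultimately show ?thesis by simp
  qed
  then have "A *\<^sub>v v = k \<cdot>\<^sub>v v" using Av uv by auto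
  then show ?thesis using that[OF uv Au _ indep] by blast
qed

section \<open>The Laplacian of a weighted graph\<close>

definition edge_weight :: "nat set set \<Rightarrow> (nat set \<Rightarrow> real) \<Rightarrow> nat \<Rightarrow> nat \<Rightarrow> real" where
  "edge_weight E w i j = (if {i, j} \<in> E then w {i, j} else 0)"

lemma edge_weight_commute: "edge_weight E w i j = edge_weight E w j i"
  by (simp add: edge_weight_def insert_commute)

lemma laplacian_carrier [simp]: "laplacian n E w \<in> carrier_mat n n"
  unfolding laplacian_def degree_matrix_def adjacency_matrix_def
  by (intro minus_carrier_mat mat_carrier)

lemma laplacian_index:
  assumes "i < n" "j < n"
  shows "laplacian n E w $$ (i, j) = (if i = j then weighted_degree E w i else 0) - edge_weight E w i j"
  using assms by (simp add: laplacian_def degree_matrix_def adjacency_matrix_def edge_weight_def)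

lemma laplacian_symmetric: "(laplacian n E w)\<^sup>T = laplacian n E w"
  using laplacian_carrier[of n E w]
  by (intro eq_matI) (auto simp: laplacian_index edge_weight_commute simp del: laplacian_carrier)

context weighted_graph
begin

lemma finite_edges: "finite E"
  using edges by (rule finite_subset) auto

lemma edge_weight_nonneg: "edge_weight E w i j \<ge> 0"
  using weight_pos[of "{i, j}"] by (auto simp: edge_weight_def intro: less_imp_le)

lemma weighted_degree_eq_sum:
  assumes "i < n"
  shows "weighted_degree E w i = (\<Sum>j<n. edge_weight E w i j)"
proof -
  have "(\<Sum>j<n. edge_weight E w i j) = (\<Sum>j | j < n \<and> {i, j} \<in> E. w {i, j})"
    unfolding edge_weight_def by (subst sum.inter_filter[symmetric]) (auto intro: sum.cong)
  also have "\<dots> = (\<Sum>e | e \<in> E \<and> i \<in> e. w e)"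
  proof (rule sum.reindex_bij_betw)
    show "bij_betw (\<lambda>j. {i, j}) {j. j < n \<and> {i, j} \<in> E} {e \<in> E. i \<in> e}"
    proof (rule bij_betw_imageI)
      show "inj_on (\<lambda>j. {i, j}) {j. j < n \<and> {i, j} \<in> E}"
        by (auto simp: inj_on_def doubleton_eq_iff)
      have "e \<in> (\<lambda>j. {i, j}) ` {j. j < n \<and> {i, j} \<in> E}" if e_i: "e \<in> E" "i \<in> e" for e
      proof -
        have e: "e \<subseteq> {..<n}" "card e = 2" using e_i(1) edges by auto
        then obtain j where "e = {i, j}" using e_i(2) by (auto simp: card_2_iff)
        then show ?thesis using e e_i by auto
      qed
      then show "(\<lambda>j. {i, j}) ` {j. j < n \<and> {i, j} \<in> E} = {e \<in> E. i \<in> e}" by auto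
    qed
  qed
  finally show ?thesis by (simp add: weighted_degree_def)
qed

lemma laplacian_mult_vec_index:
  assumes x: "x \<in> carrier_vec n" and i: "i < n"
  shows "(laplacian n E w *\<^sub>v x) $ i = (\<Sum>j<n. edge_weight E w i j * (x $ i - x $ j))"
proof -
  have "(laplacian n E w *\<^sub>v x) $ i = (\<Sum>j<n. laplacian n E w $$ (i, j) * x $ j)"
    using x i laplacian_carrier[of n E w]
    by (simp add: scalar_prod_def lessThan_atLeast0 del: laplacian_carrier)
  also have "\<dots> = (\<Sum>j<n. (if i = j then weighted_degree E w i * x $ i else 0) - edge_weight E w i j * x $ j)"
    using i by (intro sum.cong) (auto simp: laplacian_index algebra_simps)
  also have "\<dots> = weighted_degree E w i * x $ i - (\<Sum>j<n. edge_weight E w i j * x $ j)"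
    using i by (simp add: sum_subtractf)
  finally show ?thesis
    by (simp add: weighted_degree_eq_sum[OF i] sum_distrib_right right_diff_distrib sum_subtractf)
qed

text \<open>
  Row \<open>i\<close> contributes the terms \<open>w\<^bsub>ij\<^esub> x\<^sub>i (x\<^sub>i - x\<^sub>j)\<close>; adding to each of them its mirror image under
  swapping \<open>i\<close> and \<open>j\<close> completes the square.
\<close>

lemma laplacian_quadratic_form:
  assumes x: "x \<in> carrier_vec n"
  shows "x \<bullet> (laplacian n E w *\<^sub>v x)
    = 1/2 * (\<Sum>i<n. \<Sum>j<n. edge_weight E w i j * (x $ i - x $ j)\<^sup>2)"
proof -
  let ?S = "\<Sum>i<n. \<Sum>j<n. edge_weight E w i j * (x $ i * (x $ i - x $ j))"
  have dim: "dim_vec (laplacian n E w *\<^sub>v x) = n"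
    using laplacian_carrier[of n E w] by (simp del: laplacian_carrier)
  have S: "x \<bullet> (laplacian n E w *\<^sub>v x) = ?S"
    unfolding scalar_prod_def dim using x
    by (auto simp: laplacian_mult_vec_index sum_distrib_left lessThan_atLeast0 mult.left_commute
        simp del: index_mult_mat_vec intro!: sum.cong)
  have "?S = (\<Sum>i<n. \<Sum>j<n. edge_weight E w i j * (x $ j * (x $ j - x $ i)))"
    by (subst sum.swap) (simp add: edge_weight_commute)
  then have "2 * ?S = (\<Sum>i<n. \<Sum>j<n. edge_weight E w i j * (x $ i * (x $ i - x $ j))
      + edge_weight E w i j * (x $ j * (x $ j - x $ i)))"
    by (simp add: sum.distrib)
  also have "\<dots> = (\<Sum>i<n. \<Sum>j<n. edge_weight E w i j * (x $ i - x $ j)\<^sup>2)"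
    by (intro sum.cong refl) (simp add: power2_eq_square algebra_simps)
  finally show ?thesis using S by simp
qed

lemma laplacian_eigenvalue_nonneg:
  assumes "poly (char_poly (laplacian n E w)) k = 0"
  shows "k \<ge> 0"
proof -
  obtain x where x: "x \<in> carrier_vec n" "x \<noteq> 0\<^sub>v n" "laplacian n E w *\<^sub>v x = k \<cdot>\<^sub>v x"
    using assms laplacian_carrier[of n E w]
    unfolding eigenvalue_root_char_poly[OF laplacian_carrier, symmetric] eigenvalue_def eigenvector_def
    by (auto simp del: laplacian_carrier)
  have "k * (x \<bullet> x) = x \<bullet> (laplacian n E w *\<^sub>v x)"
    using x(1) by (simp add: x(3))
  also have "\<dots> \<ge> 0"
    unfolding laplacian_quadratic_form[OF x(1)]
    by (intro mult_nonneg_nonneg sum_nonneg edge_weight_nonneg) auto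
  finally have "k * (x \<bullet> x) \<ge> 0" .
  moreover have "x \<bullet> x > 0"
    using conjugate_square_greater_0_vec[OF x(1)] x(2) by (simp add: scalar_prod_def)
  ultimately show ?thesis by (simp add: zero_le_mult_iff)
qed

text \<open>
  The quadratic form vanishes on the kernel, so each of its nonnegative terms does; thus \<open>x\<close> agrees on
  the endpoints of every edge and, along paths, on all nodes.
\<close>

lemma laplacian_kernel_constant:
  assumes conn: "graph_connected n E"
    and x: "x \<in> carrier_vec n" and ker: "laplacian n E w *\<^sub>v x = 0\<^sub>v n"
    and u: "u < n" and v: "v < n"
  shows "x $ u = x $ v"
proof -
  have "(\<Sum>i<n. \<Sum>j<n. edge_weight E w i j * (x $ i - x $ j)\<^sup>2) = 0"
    using laplacian_quadratic_form[OF x] x by (simp add: ker)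
  then have zero: "edge_weight E w i j * (x $ i - x $ j)\<^sup>2 = 0" if "i < n" "j < n" for i j
    using that by (subst (asm) sum_nonneg_eq_0_iff;
        auto intro!: sum_nonneg mult_nonneg_nonneg edge_weight_nonneg simp: sum_nonneg_eq_0_iff edge_weight_nonneg)
  have step: "x $ i = x $ j" if "{i, j} \<in> E" for i j
  proof -
    have "i < n" "j < n" using that edges by auto
    from zero[OF this] show ?thesis using that weight_pos[OF that] by (simp add: edge_weight_def)
  qed
  have "(u, v) \<in> {(a, b). {a, b} \<in> E}\<^sup>*"
    using conn u v by (simp add: graph_connected_def)
  then show ?thesis by (induction rule: rtrancl_induct) (auto simp: step)
qed

lemma laplacian_trace: "sum_list (diag_mat (laplacian n E w)) = 2 * total_weight E w"
proof -
  have no_loop: "edge_weight E w i i = 0" for i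
    using edges by (auto simp: edge_weight_def)
  have "sum_list (diag_mat (laplacian n E w)) = (\<Sum>i<n. weighted_degree E w i)"
    using laplacian_carrier[of n E w]
    by (simp add: diag_mat_def interv_sum_list_conv_sum_set_nat laplacian_index no_loop
        lessThan_atLeast0 del: laplacian_carrier)
  also have "\<dots> = (\<Sum>i<n. \<Sum>e\<in>E. if i \<in> e then w e else 0)"
    unfolding weighted_degree_def by (simp add: sum.inter_filter finite_edges)
  also have "\<dots> = (\<Sum>e\<in>E. \<Sum>i<n. if i \<in> e then w e else 0)"
    by (rule sum.swap)
  also have "\<dots> = (\<Sum>e\<in>E. 2 * w e)"
  proof (rule sum.cong[OF refl])
    fix e assume "e \<in> E"
    then have "{i \<in> {..<n}. i \<in> e} = e" "card e = 2" using edges by auto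
    then show "(\<Sum>i<n. if i \<in> e then w e else 0) = 2 * w e"
      by (simp flip: sum.inter_filter)
  qed
  finally show ?thesis by (simp add: total_weight_def sum_distrib_left)
qed

text \<open>
  Otherwise \<open>0\<close> would be a double root of the characteristic polynomial, and the kernel would contain
  two linearly independent vectors, although all its elements are constant.
\<close>

lemma laplacian_second_eigenvalue_pos:
  assumes conn: "graph_connected n E"
    and es: "char_poly (laplacian n E w) = (\<Prod>e\<leftarrow>a # b # es. [:- e, 1:])"
    and ab: "a \<le> b"
  shows "b > 0"
proof (rule ccontr)
  assume "\<not> b > 0"
  moreover have "a \<ge> 0" "b \<ge> 0"
    using laplacian_eigenvalue_nonneg unfolding es by auto
  ultimately have "a = 0" "b = 0" using ab by auto
  with es obtain u v where uv: "u \<in> carrier_vec n" "v \<in> carrier_vec n"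
    "laplacian n E w *\<^sub>v u = 0 \<cdot>\<^sub>v u" "laplacian n E w *\<^sub>v v = 0 \<cdot>\<^sub>v v"
    and indep: "\<And>a b. a \<cdot>\<^sub>v u + b \<cdot>\<^sub>v v = 0\<^sub>v n \<Longrightarrow> a = 0 \<and> b = 0"
    using symmetric_double_eigenvalue_independent_eigenvectors[OF laplacian_carrier laplacian_symmetric]
    by metis
  then have ker: "laplacian n E w *\<^sub>v u = 0\<^sub>v n" "laplacian n E w *\<^sub>v v = 0\<^sub>v n" by auto
  have u_const: "u $ i = u $ 0" and v_const: "v $ i = v $ 0" if "i < n" for i
    using laplacian_kernel_constant[OF conn uv(1) ker(1), of i 0]
      laplacian_kernel_constant[OF conn uv(2) ker(2), of i 0] that by auto
  have "v $ 0 \<cdot>\<^sub>v u + (- u $ 0) \<cdot>\<^sub>v v = 0\<^sub>v n"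
  proof (rule eq_vecI)
    fix i assume "i < dim_vec (0\<^sub>v n :: real vec)"
    then show "(v $ 0 \<cdot>\<^sub>v u + (- u $ 0) \<cdot>\<^sub>v v) $ i = 0\<^sub>v n $ i"
      using uv u_const[of i] v_const[of i] by simp
  qed (use uv in auto)
  from indep[OF this] have "u $ 0 = 0" by simp
  then have "u = 0\<^sub>v n"
    using uv(1) u_const by (intro eq_vecI) auto
  then have "1 \<cdot>\<^sub>v u + 0 \<cdot>\<^sub>v v = 0\<^sub>v n"
    using uv(2) by (intro eq_vecI) auto
  then show False using indep[of 1 0] by simp
qed

end

section \<open>The lower bound\<close>

text \<open>
  The harmonic-arithmetic mean inequality, with an upper bound \<open>s\<close> in place of the sum. The
  function \<open>1 / y\<close> lies above its tangent \<open>2 t - t\<^sup>2 y\<close> at \<open>y = 1 / t\<close>; summing this at the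
  point \<open>1 / t = s / card I\<close> gives the bound when \<open>I\<close> is finite and nonempty.
\<close>

lemma sum_inverse_ge_card_square:
  fixes f :: "'i \<Rightarrow> real"
  assumes pos: "\<And>i. i \<in> I \<Longrightarrow> f i > 0" and le: "sum f I \<le> s"
  shows "(\<Sum>i\<in>I. inverse (f i)) \<ge> (real (card I))\<^sup>2 / s"
proof -
  define t where "t = real (card I) / s"
  have "inverse y \<ge> 2 * t - t\<^sup>2 * y" if "y > 0" for y :: real
  proof -
    have "(t * y - 1)\<^sup>2 \<ge> 0" by simp
    then show ?thesis using that by (simp add: field_simps power2_eq_square)
  qed
  then have tangent: "(\<Sum>i\<in>I. 2 * t - t\<^sup>2 * f i) \<le> (\<Sum>i\<in>I. inverse (f i))"
    using pos by (intro sum_mono) auto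
  \<comment> \<open>If \<open>s = 0\<close>, then \<open>t = 0\<close> and both sides are \<open>0\<close>, since division by zero yields zero.\<close>
  have "(real (card I))\<^sup>2 / s = real (card I) * (2 * t) - t\<^sup>2 * s"
    by (cases "s = 0") (simp_all add: t_def field_simps power2_eq_square)
  also have "\<dots> \<le> real (card I) * (2 * t) - t\<^sup>2 * sum f I"
    using le by (simp add: mult_left_mono)
  also have "\<dots> = (\<Sum>i\<in>I. 2 * t - t\<^sup>2 * f i)"
    by (simp add: sum_subtractf sum_distrib_left)
  also note tangent
  finally show ?thesis .
qed

theorem theorem10:
  fixes n :: nat and E :: "nat set set" and w :: "nat set \<Rightarrow> real"
  assumes "weighted_graph n E w"
    and "graph_connected n E"
    and "n \<ge> 2"
  shows "rho_ss (laplacian n E w) \<ge> (real n - 1)\<^sup>2 / (4 * total_weight E w)"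
proof -
  interpret weighted_graph n E w by fact
  let ?L = "laplacian n E w"
  define es where "es = sorted_eigenvalues ?L"
  have cp: "char_poly ?L = (\<Prod>e\<leftarrow>es. [:- e, 1:])" and len: "length es = n"
    unfolding es_def
    by (rule char_poly_sorted_eigenvalues[OF laplacian_carrier laplacian_symmetric],
        rule length_sorted_eigenvalues[OF laplacian_carrier laplacian_symmetric])
  have sorted: "sorted es" by (simp add: es_def sorted_eigenvalues_def)
  obtain a b rest where ab: "es = a # b # rest"
    using len \<open>n \<ge> 2\<close> by (metis Suc_le_length_iff numeral_2_eq_2)
  have "b > 0"
    using laplacian_second_eigenvalue_pos[OF \<open>graph_connected n E\<close> cp[unfolded ab]] sorted ab by simp
  then have pos: "es ! i > 0" if "i \<in> {1..<n}" for i
    using sorted_nth_mono[OF sorted, of 1 i] that len ab by auto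
  have "a \<ge> 0" using laplacian_eigenvalue_nonneg[of a] unfolding cp ab by simp
  have "2 * total_weight E w = sum_list es"
    using trace_eq_sum_eigenvalues[OF laplacian_carrier cp] laplacian_trace by simp
  also have "\<dots> = a + (\<Sum>i=1..<n. es ! i)"
  proof -
    have "sum_list es = (\<Sum>i=0..<n. es ! i)" by (simp add: sum_list_sum_nth len)
    then show ?thesis using \<open>n \<ge> 2\<close> ab by (simp add: sum.atLeast_Suc_lessThan)
  qed
  finally have le: "(\<Sum>i=1..<n. es ! i) \<le> 2 * total_weight E w" using \<open>a \<ge> 0\<close> by simp
  have dim: "dim_row ?L = n" using laplacian_carrier[of n E w] by (rule carrier_matD)
  have "rho_ss ?L = 1/2 * (\<Sum>i=1..<n. inverse (es ! i))"
    unfolding rho_ss_def es_def[symmetric] dim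
    by (intro arg_cong[where f = "\<lambda>x. 1/2 * x"] sum.reindex_bij_witness[of _ Suc "\<lambda>i. i - 1"]) auto
  also have "\<dots> \<ge> 1/2 * ((real (card {1..<n}))\<^sup>2 / (2 * total_weight E w))"
    using sum_inverse_ge_card_square[OF pos le] by simp
  finally show ?thesis using \<open>n \<ge> 2\<close> by (simp add: of_nat_diff)
qed

end
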